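(* The system of difference equations $$x_{n+1}=\frac{1}{y_n(x_{n-1}+1)+1},\qquad y_{n+1}=\frac{1}{x_n(y_{n-1}+1)+1},\qquad n=0,1,2,\dots,$$ has a unique positive equilibrium point, namely $(\overline{x},\overline{y})=(a,a)$ with $$a=\frac{-1+\sqrt[3]{3\sqrt{33}+17}-\sqrt[3]{3\sqrt{33}-17}}{3},$$ and $(a,a)$ is locally asymptotically stable.
   Context: The number $a$ is the unique real root of $x^3+x^2+x-1=0$. Initial values $x_{-1},x_0,y_{-1},y_0$ are real. An equilibrium point is a point $(\overline{x},\overline{y})\in\mathbb{R}^2$ such that the constant sequences $x_n=\overline{x}$, $y_n=\overline{y}$ satisfy the system; it is positive if $\overline{x}>0$ and $\overline{y}>0$. An equilibrium point $(\overline{x},\overline{y})$ is stable if for every $\varepsilon>0$ there exists $\delta>0$ such that whenever $|x_{-i}-\overline{x}|<\delta$ and $|y_{-i}-\overline{y}|<\delta$ for $i=0,1$, the solution is well defined (no denominator vanishes) and satisfies $|x_n-\overline{x}|<\varepsilon$, $|y_n-\overline{y}|<\varepsilon$ for all $n\ge 0$. It is locally asymptotically stable if it is stable and in addition there exists $\gamma>0$ such that whenever $|x_{-i}-\overline{x}|<\gamma$ and $|y_{-i}-\overline{y}|<\gamma$ for $i=0,1$, one has $(x_n,y_n)\to(\overline{x},\overline{y})$ as $n\to\infty$. *)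

theory Defs
  imports Complex_Main
begin

text \<open>
  A sequence indexed by \<open>-1, 0, 1, \<dots>\<close> is represented by a function on \<open>nat\<close> shifted by one:
  \<open>x k\<close> stands for the term with index \<open>k - 1\<close>. Since division by zero is \<open>0\<close> in HOL, a (well-defined)
  solution is required explicitly to have nonvanishing denominators.
\<close>

definition is_solution :: "(nat \<Rightarrow> real) \<Rightarrow> (nat \<Rightarrow> real) \<Rightarrow> bool" where
  "is_solution x y \<longleftrightarrow>
     (\<forall>n. y (n + 1) * (x n + 1) + 1 \<noteq> 0 \<and>
          x (n + 1) * (y n + 1) + 1 \<noteq> 0 \<and>
          x (n + 2) = 1 / (y (n + 1) * (x n + 1) + 1) \<and>
          y (n + 2) = 1 / (x (n + 1) * (y n + 1) + 1))"

definition equilibrium :: "real \<times> real \<Rightarrow> bool" where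
  "equilibrium = (\<lambda>(xb, yb). is_solution (\<lambda>_. xb) (\<lambda>_. yb))"

definition positive_equilibrium :: "real \<times> real \<Rightarrow> bool" where
  "positive_equilibrium p \<longleftrightarrow> equilibrium p \<and> fst p > 0 \<and> snd p > 0"

definition initial_within ::
  "real \<Rightarrow> real \<times> real \<Rightarrow> real \<Rightarrow> real \<Rightarrow> real \<Rightarrow> real \<Rightarrow> bool" where
  "initial_within d = (\<lambda>(xb, yb) xm1 x0 ym1 y0.
     \<bar>xm1 - xb\<bar> < d \<and> \<bar>x0 - xb\<bar> < d \<and> \<bar>ym1 - yb\<bar> < d \<and> \<bar>y0 - yb\<bar> < d)"

definition solution_from ::
  "real \<Rightarrow> real \<Rightarrow> real \<Rightarrow> real \<Rightarrow> (nat \<Rightarrow> real) \<Rightarrow> (nat \<Rightarrow> real) \<Rightarrow> bool" where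
  "solution_from xm1 x0 ym1 y0 x y \<longleftrightarrow>
     is_solution x y \<and> x 0 = xm1 \<and> x 1 = x0 \<and> y 0 = ym1 \<and> y 1 = y0"

text \<open>
  A solution is uniquely determined by its initial values, so the existential quantifier over
  \<open>x y\<close> below asserts that \<^emph>\<open>the\<close> solution is well defined and has the stated property.
\<close>

definition stable :: "real \<times> real \<Rightarrow> bool" where
  "stable p \<longleftrightarrow> equilibrium p \<and>
     (\<forall>\<epsilon>>0. \<exists>\<delta>>0. \<forall>xm1 x0 ym1 y0. initial_within \<delta> p xm1 x0 ym1 y0 \<longrightarrow>
        (\<exists>x y. solution_from xm1 x0 ym1 y0 x y \<and>
               (\<forall>n. \<bar>x (n + 1) - fst p\<bar> < \<epsilon> \<and> \<bar>y (n + 1) - snd p\<bar> < \<epsilon>)))"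

definition locally_asymptotically_stable :: "real \<times> real \<Rightarrow> bool" where
  "locally_asymptotically_stable p \<longleftrightarrow> stable p \<and>
     (\<exists>\<gamma>>0. \<forall>xm1 x0 ym1 y0. initial_within \<gamma> p xm1 x0 ym1 y0 \<longrightarrow>
        (\<exists>x y. solution_from xm1 x0 ym1 y0 x y \<and>
               (\<lambda>n. (x (n + 1), y (n + 1))) \<longlonglongrightarrow> p))"

definition root_a :: real where
  "root_a = (THE z. z ^ 3 + z ^ 2 + z - 1 = 0)"

end

theory Submission
  imports Defs
begin

text \<open>
  On the nonnegative quadrant the map \<open>(u, v) \<mapsto> 1 / (v (u + 1) + 1)\<close> brings points closer to the
  fixed value \<open>a\<close> by a uniform factor \<open>K < 1\<close> in the maximum norm. Indeed
  \<open>1 / D - a = (a / D) ((a - v) (a + 1) + v (a - u))\<close> with \<open>D = v (u + 1) + 1\<close>, and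
  \<open>a (a + 1) + a v \<le> K (1 + v) \<le> K D\<close> for \<open>K = max (1 - a\<^sup>3) a\<close>, because \<open>a + a\<^sup>2 = 1 - a\<^sup>3\<close>.
  As the quadrant is invariant, deviations from \<open>a\<close> shrink by \<open>K\<close> every two steps.
\<close>

text \<open>Subtracting the two equations gives \<open>z - w\<close> times a quadratic form, and
  twice that form is the sum of squares used below. The squares cannot all vanish:
  \<open>z = w = -1\<close> contradicts \<open>z + w = 0\<close>.\<close>

lemma cubic_root_unique:
  fixes z w :: real
  assumes "z ^ 3 + z ^ 2 + z - 1 = 0" and "w ^ 3 + w ^ 2 + w - 1 = 0"
  shows "z = w"
proof -
  have "(z - w) * ((z + w)\<^sup>2 + (z + 1)\<^sup>2 + (w + 1)\<^sup>2) = 0"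
    using assms by algebra
  moreover have "(z + w)\<^sup>2 + (z + 1)\<^sup>2 + (w + 1)\<^sup>2 \<noteq> 0"
    by (auto simp: sum_power2_eq_zero_iff add_nonneg_eq_0_iff)
  ultimately show ?thesis by simp
qed

text \<open>Cardano's method: \<open>t = 3 * z + 1\<close> turns the cubic into
  \<open>t ^ 3 + 6 * t = 34\<close>, which \<open>t = p - q\<close> solves once
  \<open>p * q = 2\<close> and \<open>p ^ 3 - q ^ 3 = 34\<close>.\<close>

lemma cardano_cubic_root:
  fixes z :: real
  defines "z \<equiv> (- 1 + root 3 (3 * sqrt 33 + 17) - root 3 (3 * sqrt 33 - 17)) / 3"
  shows "z ^ 3 + z ^ 2 + z - 1 = 0"
proof -
  define p q where "p = root 3 (3 * sqrt 33 + 17)" and "q = root 3 (3 * sqrt 33 - 17)"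
  have p3: "p ^ 3 = 3 * sqrt 33 + 17" and q3: "q ^ 3 = 3 * sqrt 33 - 17"
    unfolding p_def q_def by (simp_all add: odd_real_root_pow)
  have "p * q = root 3 ((3 * sqrt 33 + 17) * (3 * sqrt 33 - 17))"
    unfolding p_def q_def by (simp add: real_root_mult)
  also have "(3 * sqrt 33 + 17) * (3 * sqrt 33 - 17) = (2 :: real) ^ 3"
    by (simp add: algebra_simps)
  also have "root 3 \<dots> = 2"
    by (simp add: odd_real_root_power_cancel)
  finally have pq: "p * q = 2" .
  have "3 * z = p - q - 1"
    unfolding z_def p_def q_def by simp
  moreover have "p ^ 3 - q ^ 3 = 34"
    using p3 q3 by simp
  ultimately have "27 * (z ^ 3 + z ^ 2 + z - 1) = 0"
    using pq by algebra
  then show ?thesis by simp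
qed

lemma root_a_cubic: "root_a ^ 3 + root_a ^ 2 + root_a - 1 = 0"
  unfolding root_a_def
  by (rule theI[where P = "\<lambda>z. z ^ 3 + z ^ 2 + z - 1 = 0", OF cardano_cubic_root])
    (rule cubic_root_unique[OF _ cardano_cubic_root])

lemma root_a_bounds: "0 < root_a" "root_a < 1"
proof -
  \<comment> \<open>The cofactor is a quadratic without real roots, so \<open>root_a\<close>
    inherits the sign of 1.\<close>
  have eq: "root_a * (root_a\<^sup>2 + root_a + 1) = 1"
    using root_a_cubic by algebra
  have "4 * (root_a\<^sup>2 + root_a + 1) = (2 * root_a + 1)\<^sup>2 + 3"
    by algebra
  also have "\<dots> > 0"
    by (simp add: add_nonneg_pos)
  finally have "root_a\<^sup>2 + root_a + 1 > 0"
    by simp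
  then show "0 < root_a"
    using eq by (metis zero_less_mult_pos2 zero_less_one)
  then have "0 < root_a ^ 3" "0 < root_a ^ 2"
    by simp_all
  then show "root_a < 1"
    using root_a_cubic by linarith
qed

text \<open>A product equal to 1 already forces its factors to be nonzero, so the polynomial
  equations include the condition on the denominators.\<close>

lemma equilibrium_iff:
  "equilibrium (u, v) \<longleftrightarrow> u * (v * (u + 1) + 1) = 1 \<and> v * (u * (v + 1) + 1) = 1"
proof -
  have "D \<noteq> 0 \<and> z = 1 / D \<longleftrightarrow> z * D = 1" for z D :: real
    by (auto simp: eq_divide_eq)
  then show ?thesis
    unfolding equilibrium_def is_solution_def by auto
qed

text \<open>The difference of the two equations factors as \<open>(u - v) * (u * v + 1)\<close>.
  Positivity therefore forces \<open>u = v\<close>, and on the diagonal the equation is the defining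
  cubic of \<open>root_a\<close>.\<close>

lemma positive_equilibrium_iff: "positive_equilibrium p \<longleftrightarrow> p = (root_a, root_a)"
proof (cases p)
  case (Pair u v)
  have "u = root_a \<and> v = root_a"
    if e: "u * (v * (u + 1) + 1) = 1" "v * (u * (v + 1) + 1) = 1" and pos: "u > 0" "v > 0"
  proof -
    have "(u - v) * (u * v + 1) = 0"
      using e by algebra
    moreover have "u * v + 1 > 0"
      using pos by (simp add: add_pos_pos)
    ultimately have "u = v" by simp
    moreover from this have "u ^ 3 + u ^ 2 + u - 1 = 0"
      using e(1) by (simp add: power2_eq_square power3_eq_cube algebra_simps)
    ultimately show ?thesis
      using cubic_root_unique root_a_cubic by blast
  qed
  moreover have "root_a * (root_a * (root_a + 1) + 1) = 1"
    using root_a_cubic by algebra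
  ultimately show ?thesis
    using root_a_bounds unfolding positive_equilibrium_def Pair by (auto simp: equilibrium_iff)
qed

definition contraction_factor :: real where
  "contraction_factor = max (1 - root_a ^ 3) root_a"

lemma contraction_factor_bounds: "0 < contraction_factor" "contraction_factor < 1"
  using root_a_bounds by (auto simp: contraction_factor_def)

text \<open>Stated for an arbitrary common bound \<open>M\<close>, so that geometric bounds can be
  inserted directly when the step is iterated.\<close>

lemma step_contraction:
  fixes u v :: real
  assumes "0 \<le> u" "0 \<le> v" "\<bar>u - root_a\<bar> \<le> M" "\<bar>v - root_a\<bar> \<le> M"
  shows "\<bar>1 / (v * (u + 1) + 1) - root_a\<bar> \<le> contraction_factor * M"
proof -
  let ?a = root_a and ?K = contraction_factor
  define D where "D = v * (u + 1) + 1"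
  have "D > 0"
    unfolding D_def using assms by (simp add: add_nonneg_pos)
  have M: "0 \<le> M" using assms by linarith
  \<comment> \<open>The cubic replaces \<open>1 - ?a\<close> by \<open>?a ^ 2 * (?a + 1)\<close>,
    which leaves only terms linear in the deviations.\<close>
  have "1 - ?a * D = ?a * (?a + 1) * (?a - v) + ?a * v * (?a - u)"
    unfolding D_def using root_a_cubic by algebra
  also have "\<bar>\<dots>\<bar> \<le> ?a * (?a + 1) * M + ?a * v * M"
    using root_a_bounds assms
    by (intro order_trans[OF abs_triangle_ineq] add_mono)
      (auto simp: abs_mult abs_minus_commute intro!: mult_left_mono)
  also have "\<dots> = (?a * (?a + 1) + ?a * v) * M"
    by (simp add: algebra_simps)
  also have "\<dots> \<le> (?K * D) * M"
  proof (rule mult_right_mono[OF _ M])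
    have "?a * (?a + 1) = 1 - ?a ^ 3"
      using root_a_cubic by algebra
    also have "\<dots> \<le> ?K" by (simp add: contraction_factor_def)
    finally have "?a * (?a + 1) \<le> ?K" .
    moreover have "?a * v \<le> ?K * v"
      using assms by (intro mult_right_mono) (auto simp: contraction_factor_def)
    \<comment> \<open>This is the surplus of \<open>?K * D\<close> over
      \<open>?K * (1 + v)\<close>.\<close>
    moreover have "0 \<le> ?K * (v * u)"
      using assms contraction_factor_bounds by simp
    ultimately show "?a * (?a + 1) + ?a * v \<le> ?K * D"
      by (simp add: D_def algebra_simps)
  qed
  finally have "\<bar>1 - ?a * D\<bar> / D \<le> ?K * M"
    using \<open>D > 0\<close> by (simp add: field_simps)
  moreover have "1 / D - ?a = (1 - ?a * D) / D"
    using \<open>D > 0\<close> by (simp add: field_simps)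
  ultimately show ?thesis
    using \<open>D > 0\<close> by (simp add: D_def[symmetric])
qed

lemma positive_solution_exists:
  assumes "xm1 > 0" "x0 > 0" "ym1 > 0" "y0 > 0"
  shows "\<exists>x y. solution_from xm1 x0 ym1 y0 x y \<and> (\<forall>n. x n > 0 \<and> y n > 0)"
proof -
  \<comment> \<open>The state holds two consecutive terms of each sequence, which makes the
    second-order system a first-order iteration.\<close>
  define f :: "real \<times> real \<times> real \<times> real \<Rightarrow> real \<times> real \<times> real \<times> real" where
    "f = (\<lambda>(u, u', v, v'). (u', 1 / (v' * (u + 1) + 1), v', 1 / (u' * (v + 1) + 1)))"
  define s where "s n = (f ^^ n) (xm1, x0, ym1, y0)" for n
  define x y where "x n = fst (s n)" and "y n = fst (snd (snd (s n)))" for n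
  have s_Suc: "s (Suc n) = f (s n)" for n
    by (simp add: s_def)
  have x1: "x (Suc n) = fst (snd (s n))" and y1: "y (Suc n) = snd (snd (snd (s n)))" for n
    by (simp_all add: x_def y_def s_Suc f_def split: prod.splits)
  have x2: "x (Suc (Suc n)) = 1 / (y (Suc n) * (x n + 1) + 1)"
    and y2: "y (Suc (Suc n)) = 1 / (x (Suc n) * (y n + 1) + 1)" for n
    by (simp_all add: x1 y1) (simp_all add: x_def y_def s_Suc f_def split: prod.splits)
  have init: "x 0 = xm1" "x (Suc 0) = x0" "y 0 = ym1" "y (Suc 0) = y0"
    by (simp_all add: x1 y1) (simp_all add: x_def y_def s_def)
  have pos: "x n > 0 \<and> y n > 0" for n
    by (induction n rule: induct_nat_012)
      (use assms in \<open>auto simp: init x2 y2 intro!: divide_pos_pos add_pos_pos mult_pos_pos\<close>)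
  then have "y (Suc n) * (x n + 1) + 1 > 0" "x (Suc n) * (y n + 1) + 1 > 0" for n
    by (auto intro!: add_pos_pos mult_pos_pos)
  then have "is_solution x y"
    unfolding is_solution_def by (simp add: x2 y2 less_imp_neq[symmetric])
  then show ?thesis
    using init pos unfolding solution_from_def by auto
qed

text \<open>Each term depends on the two before it, so a factor \<open>contraction_factor\<close> is
  gained only every second index; hence the exponent \<open>n div 2\<close>.\<close>

lemma deviation_bound:
  assumes "is_solution x y" and pos: "\<And>n. 0 \<le> x n" "\<And>n. 0 \<le> y n"
    and init: "\<bar>x 0 - root_a\<bar> \<le> d" "\<bar>x 1 - root_a\<bar> \<le> d" "\<bar>y 0 - root_a\<bar> \<le> d" "\<bar>y 1 - root_a\<bar> \<le> d"
  shows "\<bar>x n - root_a\<bar> \<le> contraction_factor ^ (n div 2) * d \<and>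
    \<bar>y n - root_a\<bar> \<le> contraction_factor ^ (n div 2) * d"
proof (induction n rule: induct_nat_012)
  case (ge2 n)
  let ?K = contraction_factor
  have "d \<ge> 0" using init by linarith
  \<comment> \<open>The newer term may have the smaller bound; weakening it gives all four
    deviations the same \<open>M\<close>.\<close>
  then have "?K ^ (Suc n div 2) * d \<le> ?K ^ (n div 2) * d"
    using contraction_factor_bounds
    by (intro mult_right_mono power_decreasing div_le_mono) auto
  with ge2 have "\<bar>x n - root_a\<bar> \<le> ?K ^ (n div 2) * d" "\<bar>y n - root_a\<bar> \<le> ?K ^ (n div 2) * d"
    "\<bar>x (Suc n) - root_a\<bar> \<le> ?K ^ (n div 2) * d" "\<bar>y (Suc n) - root_a\<bar> \<le> ?K ^ (n div 2) * d"
    by linarith+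
  moreover have "x (Suc (Suc n)) = 1 / (y (Suc n) * (x n + 1) + 1)"
    "y (Suc (Suc n)) = 1 / (x (Suc n) * (y n + 1) + 1)"
    using assms(1) by (simp_all add: is_solution_def)
  ultimately show ?case
    using step_contraction pos by (simp add: mult.assoc)
qed (use init in simp_all)

lemma locally_asymptotically_stable_root_a: "locally_asymptotically_stable (root_a, root_a)"
proof -
  let ?K = contraction_factor
  \<comment> \<open>With \<open>d \<le> root_a\<close>, initial values within \<open>d\<close> of
    \<open>root_a\<close> are positive, so the solution exists and the deviation bound
    applies.\<close>
  have solution: "\<exists>x y. solution_from xm1 x0 ym1 y0 x y \<and>
      (\<forall>n. \<bar>x n - root_a\<bar> \<le> ?K ^ (n div 2) * d \<and> \<bar>y n - root_a\<bar> \<le> ?K ^ (n div 2) * d)"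
    if "d \<le> root_a" "initial_within d (root_a, root_a) xm1 x0 ym1 y0" for d xm1 x0 ym1 y0
  proof -
    have i: "\<bar>xm1 - root_a\<bar> < d" "\<bar>x0 - root_a\<bar> < d" "\<bar>ym1 - root_a\<bar> < d" "\<bar>y0 - root_a\<bar> < d"
      using that by (auto simp: initial_within_def)
    then have "xm1 > 0" "x0 > 0" "ym1 > 0" "y0 > 0"
      using that(1) by linarith+
    then obtain x y where xy: "solution_from xm1 x0 ym1 y0 x y" "\<forall>n. x n > 0 \<and> y n > 0"
      using positive_solution_exists by blast
    then have "\<bar>x n - root_a\<bar> \<le> ?K ^ (n div 2) * d \<and> \<bar>y n - root_a\<bar> \<le> ?K ^ (n div 2) * d" for n
      using i by (intro deviation_bound) (auto simp: solution_from_def less_imp_le)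
    with xy show ?thesis by blast
  qed
  have "stable (root_a, root_a)"
    unfolding stable_def
  proof (intro conjI allI impI)
    show "equilibrium (root_a, root_a)"
      using positive_equilibrium_iff positive_equilibrium_def by blast
  next
    fix \<epsilon> :: real assume "\<epsilon> > 0"
    \<comment> \<open>Halving \<open>\<epsilon>\<close> keeps the non-strict deviation bound
      strictly below \<open>\<epsilon>\<close>.\<close>
    define d where "d = min root_a (\<epsilon> / 2)"
    have d: "0 < d" "d \<le> root_a" "d < \<epsilon>"
      using \<open>\<epsilon> > 0\<close> root_a_bounds by (auto simp: d_def)
    have "?K ^ m * d < \<epsilon>" for m
    proof -
      have "?K ^ m * d \<le> 1 * d"
        using contraction_factor_bounds d by (intro mult_right_mono power_le_one) auto
      with d show ?thesis by linarith
    qed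
    then have "\<exists>x y. solution_from xm1 x0 ym1 y0 x y \<and>
        (\<forall>n. \<bar>x (n + 1) - root_a\<bar> < \<epsilon> \<and> \<bar>y (n + 1) - root_a\<bar> < \<epsilon>)"
      if "initial_within d (root_a, root_a) xm1 x0 ym1 y0" for xm1 x0 ym1 y0
      using solution[OF d(2) that] by (meson le_less_trans)
    with d(1) show "\<exists>\<delta>>0. \<forall>xm1 x0 ym1 y0. initial_within \<delta> (root_a, root_a) xm1 x0 ym1 y0 \<longrightarrow>
        (\<exists>x y. solution_from xm1 x0 ym1 y0 x y \<and>
          (\<forall>n. \<bar>x (n + 1) - fst (root_a, root_a)\<bar> < \<epsilon> \<and> \<bar>y (n + 1) - snd (root_a, root_a)\<bar> < \<epsilon>))"
      by auto
  qed
  moreover have "\<exists>x y. solution_from xm1 x0 ym1 y0 x y \<and>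
      (\<lambda>n. (x (n + 1), y (n + 1))) \<longlonglongrightarrow> (root_a, root_a)"
    if init: "initial_within root_a (root_a, root_a) xm1 x0 ym1 y0" for xm1 x0 ym1 y0
  proof -
    obtain x y where sol: "solution_from xm1 x0 ym1 y0 x y"
      and dev: "\<And>n. \<bar>x n - root_a\<bar> \<le> ?K ^ (n div 2) * root_a"
        "\<And>n. \<bar>y n - root_a\<bar> \<le> ?K ^ (n div 2) * root_a"
      using solution[OF order_refl init] by blast
    \<comment> \<open>For a threshold \<open>m\<close>, every \<open>n\<close> from
      \<open>2 * m\<close> on has \<open>n div 2\<close> at least \<open>m\<close>.\<close>
    have "filterlim (\<lambda>n::nat. n div 2) at_top at_top"
      unfolding filterlim_at_top eventually_at_top_linorder
      by (metis div_le_mono nonzero_mult_div_cancel_left zero_neq_numeral)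
    moreover have "(\<lambda>n. ?K ^ n) \<longlonglongrightarrow> 0"
      using contraction_factor_bounds by (intro LIMSEQ_power_zero) auto
    ultimately have lim: "(\<lambda>n. ?K ^ (n div 2) * root_a) \<longlonglongrightarrow> 0"
      by (intro tendsto_mult_left_zero) (rule filterlim_compose)
    have "z \<longlonglongrightarrow> root_a" if "\<And>n. \<bar>z n - root_a\<bar> \<le> ?K ^ (n div 2) * root_a" for z
    proof (rule LIM_zero_cancel, rule tendsto_0_le[OF lim, where K = 1])
      show "\<forall>\<^sub>F n in sequentially. norm (z n - root_a) \<le> norm (?K ^ (n div 2) * root_a) * 1"
        using that by (intro always_eventually allI) (metis abs_ge_self mult_1_right order_trans real_norm_def)
    qed
    from this[OF dev(1)] this[OF dev(2)]
    have "(\<lambda>n. (x (n + 1), y (n + 1))) \<longlonglongrightarrow> (root_a, root_a)"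
      by (intro tendsto_Pair LIMSEQ_ignore_initial_segment)
    with sol show ?thesis by blast
  qed
  ultimately show ?thesis
    unfolding locally_asymptotically_stable_def using root_a_bounds(1) by blast
qed

theorem theorem6:
  shows "(\<exists>!z::real. z ^ 3 + z ^ 2 + z - 1 = 0) \<and>
    root_a = (- 1 + root 3 (3 * sqrt 33 + 17) - root 3 (3 * sqrt 33 - 17)) / 3 \<and>
    (\<forall>p. positive_equilibrium p \<longleftrightarrow> p = (root_a, root_a)) \<and>
    locally_asymptotically_stable (root_a, root_a)"
  using cubic_root_unique root_a_cubic cardano_cubic_root positive_equilibrium_iff
    locally_asymptotically_stable_root_a
  by blast

end
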